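(* The strong Andrica conjecture implies the Oppermann conjecture. That is: let $p_n$ denote the $n$-th prime. Suppose that for every integer $n\ge 1$ with $p_n\notin\{3,7,13,23,31,113\}$ one has $\sqrt{p_{n+1}}-\sqrt{p_n}<\frac12$. Then for every integer $m\ge 2$ there is at least one prime in the open interval $\left(m(m-1),\,m^2\right)$ and at least one prime in the open interval $\left(m^2,\,m(m+1)\right)$.
   Context: $p_n$ denotes the $n$-th prime, with $p_1=2$. The strong Andrica conjecture is the assertion that $\sqrt{p_{n+1}}-\sqrt{p_n}<\frac12$ for all $n\geq 1$ except those with $p_n\in\{3,7,13,23,31,113\}$ (i.e. $n\in\{2,4,6,9,11,30\}$). The Oppermann conjecture is the assertion that for all integers $m\ge 2$ there is at least one prime in each of the open intervals $(m(m-1),m^2)$ and $(m^2,m(m+1))$. *)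

theory Defs
  imports Complex_Main "HOL-Library.Infinite_Set" "HOL-Computational_Algebra.Primes"
begin

(* enumerate counts from 0, whereas the primes are numbered p_1 = 2, p_2 = 3, ...
   The value at n = 0 is a dummy. *)
definition nth_prime :: "nat \<Rightarrow> nat" where
  "nth_prime n = enumerate {p. prime p} (n - 1)"

lemma nth_prime_1: "nth_prime 1 = 2"
  unfolding nth_prime_def
  by (auto simp: enumerate_0 intro!: Least_equality prime_ge_2_nat)

definition strong_Andrica_conjecture :: bool where
  "strong_Andrica_conjecture \<longleftrightarrow>
     (\<forall>n\<ge>1. nth_prime n \<notin> {3, 7, 13, 23, 31, 113} \<longrightarrow>
        sqrt (real (nth_prime (n + 1))) - sqrt (real (nth_prime n)) < 1 / 2)"

definition Oppermann_conjecture :: bool where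
  "Oppermann_conjecture \<longleftrightarrow>
     (\<forall>m::nat. m \<ge> 2 \<longrightarrow>
        (\<exists>p. prime p \<and> p \<in> {m * (m - 1)<..<m\<^sup>2}) \<and>
        (\<exists>q. prime q \<and> q \<in> {m\<^sup>2<..<m * (m + 1)}))"

end

theory Submission
  imports Defs
begin

text \<open>
  Andrica's bound says that no interval whose endpoints have square roots at least \<open>1/2\<close> apart
  fits between two consecutive primes (\<open>prime_between_if_sqrt_gap\<close>).

  The left interval \<open>(m(m - 1), m\<^sup>2)\<close> is long enough for this, because
  \<open>m(m - 1) < (m - 1/2)\<^sup>2\<close>. The right interval \<open>(m\<^sup>2, m(m + 1))\<close> is slightly too short, as
  \<open>m(m + 1) < (m + 1/2)\<^sup>2\<close>. But its endpoints are composite, so if it contains no prime, then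
  neither does \<open>(m\<^sup>2 - 1, m(m + 1) + 1)\<close>, and this interval is long enough because
  \<open>(m + 1/2)\<^sup>2 < m(m + 1) + 1\<close>.

  The exceptional primes end at \<open>113\<close>, whose successor is \<open>127\<close>. For \<open>m \<ge> 12\<close> all the numbers
  involved exceed \<open>127\<close>; the remaining values of \<open>m\<close> are settled by exhibiting primes.
\<close>

text \<open>
  The bound is applied to the least prime above \<open>x\<close> and its predecessor. The latter is at most
  \<open>x\<close>, and it cannot be exceptional because the prime \<open>127\<close> would then lie strictly between
  two consecutive primes.
\<close>

lemma prime_between_if_sqrt_gap:
  fixes x y :: nat
  assumes andrica: "strong_Andrica_conjecture"
    and large: "127 \<le> x"
    and gap: "1 / 2 \<le> sqrt (real y) - sqrt (real x)"
  shows "\<exists>q. prime q \<and> x < q \<and> q < y"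
proof -
  let ?P = "{p::nat. prime p}"
  have inf: "infinite ?P"
    by (rule primes_infinite)
  define q where "q = (LEAST q. prime q \<and> x < q)"
  have ex: "\<exists>q. prime q \<and> x < q"
    using bigger_prime by blast
  have q: "prime q" "x < q"
    using LeastI_ex[OF ex] unfolding q_def by auto
  have q_least: "q \<le> r" if "prime r" "x < r" for r
    unfolding q_def using that by (intro Least_le) auto
  obtain j where j: "enumerate ?P j = q"
    using enumerate_Ex[OF inf, of q] q(1) by auto
  obtain i where i: "enumerate ?P i = 127"
    using enumerate_Ex[OF inf, of 127] by auto
  have "i < j"
    using i j q(2) large enumerate_mono_iff[OF inf, of i j] by simp
  then obtain k where k: "j = Suc k" "i \<le> k"
    by (cases j) auto
  define p where "p = enumerate ?P k"
  have "prime p"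
    using enumerate_in_set[OF inf, of k] by (simp add: p_def)
  have "p < q"
    using enumerate_mono[OF _ inf, of k j] j k by (simp add: p_def)
  then have "p \<le> x"
    using q_least[OF \<open>prime p\<close>] by (meson leD leI)
  have "127 \<le> p"
    using enumerate_mono_le_iff[OF inf, of i k] i k by (simp add: p_def)
  moreover have "nth_prime (k + 1) = p" "nth_prime (k + 1 + 1) = q"
    using j k by (simp_all add: nth_prime_def p_def)
  ultimately have "sqrt (real q) - sqrt (real p) < 1 / 2"
    using andrica[unfolded strong_Andrica_conjecture_def, rule_format, of "k + 1"] by auto
  moreover have "sqrt (real p) \<le> sqrt (real x)"
    using \<open>p \<le> x\<close> by simp
  ultimately have "sqrt (real q) < sqrt (real y)"
    using gap by linarith
  then show ?thesis
    using q by auto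
qed

lemma prime_left_of_square:
  fixes m :: nat
  assumes "strong_Andrica_conjecture" "12 \<le> m"
  shows "\<exists>p. prime p \<and> m * (m - 1) < p \<and> p < m\<^sup>2"
proof (rule prime_between_if_sqrt_gap[OF assms(1)])
  have "12 * 11 \<le> m * (m - 1)"
    using assms(2) by (intro mult_le_mono) auto
  then show "127 \<le> m * (m - 1)"
    by simp
  have "sqrt (real (m * (m - 1))) \<le> real m - 1 / 2"
    using assms(2)
    by (intro real_le_lsqrt) (auto simp: of_nat_diff power2_eq_square algebra_simps)
  then show "1 / 2 \<le> sqrt (real (m\<^sup>2)) - sqrt (real (m * (m - 1)))"
    by simp
qed

lemma prime_right_of_square:
  fixes m :: nat
  assumes "strong_Andrica_conjecture" "12 \<le> m"
  shows "\<exists>q. prime q \<and> m\<^sup>2 < q \<and> q < m * (m + 1)"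
proof -
  have "12 * 12 \<le> m\<^sup>2"
    unfolding power2_eq_square using assms(2) by (intro mult_le_mono) auto
  then have large: "127 \<le> m\<^sup>2 - 1"
    by simp
  have "sqrt (real (m\<^sup>2 - 1)) \<le> sqrt (real (m\<^sup>2))"
    by (intro real_sqrt_le_mono) simp
  then have lower: "sqrt (real (m\<^sup>2 - 1)) \<le> real m"
    by simp
  have upper: "real m + 1 / 2 \<le> sqrt (real (m * (m + 1) + 1))"
    by (intro real_le_rsqrt) (auto simp: power2_eq_square algebra_simps)
  have "1 / 2 \<le> sqrt (real (m * (m + 1) + 1)) - sqrt (real (m\<^sup>2 - 1))"
    using lower upper by linarith
  from prime_between_if_sqrt_gap[OF assms(1) large this]
  obtain q where q: "prime q" "m\<^sup>2 - 1 < q" "q < m * (m + 1) + 1"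
    by blast
  have "\<not> prime (m\<^sup>2)"
    using prime_power_iff[of m 2] by simp
  moreover have "\<not> prime (m * (m + 1))"
    using assms(2) prime_product[of m "m + 1"] by auto
  ultimately have "q \<noteq> m\<^sup>2" "q \<noteq> m * (m + 1)"
    using q(1) by auto
  then have "m\<^sup>2 < q" "q < m * (m + 1)"
    using q by linarith+
  then show ?thesis
    using q(1) by blast
qed

lemma Oppermann_below_12:
  fixes m :: nat
  assumes "2 \<le> m" "m < 12"
  shows "(\<exists>p. prime p \<and> m * (m - 1) < p \<and> p < m\<^sup>2) \<and>
         (\<exists>q. prime q \<and> m\<^sup>2 < q \<and> q < m * (m + 1))"
proof -
  let ?O = "\<lambda>p q. (prime p \<and> m * (m - 1) < p \<and> p < m\<^sup>2) \<and>
                 (prime q \<and> m\<^sup>2 < q \<and> q < m * (m + 1))"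
  have "m \<in> set [2..<12]"
    using assms unfolding set_upt by simp
  then have "m \<in> {2, 3, 4, 5, 6, 7, 8, 9, 10, 11}"
    by simp
  then have "?O 3 5 \<or> ?O 7 11 \<or> ?O 13 17 \<or> ?O 23 29 \<or> ?O 31 37 \<or> ?O 43 53 \<or>
    ?O 59 67 \<or> ?O 73 83 \<or> ?O 97 101 \<or> ?O 113 127"
    by (elim insertE emptyE) simp_all
  then show ?thesis
    by blast
qed

theorem theorem1:
  assumes "strong_Andrica_conjecture"
  shows "Oppermann_conjecture"
  unfolding Oppermann_conjecture_def greaterThanLessThan_iff
proof (intro allI impI)
  fix m :: nat
  assume "2 \<le> m"
  then show "(\<exists>p. prime p \<and> m * (m - 1) < p \<and> p < m\<^sup>2) \<and>
             (\<exists>q. prime q \<and> m\<^sup>2 < q \<and> q < m * (m + 1))"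
    using Oppermann_below_12[of m] prime_left_of_square[OF assms, of m]
      prime_right_of_square[OF assms, of m]
    by (meson not_less)
qed

end
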